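(* Let $q$ be a prime power, let $n\le m$ be positive integers, and let $\mathcal{C}$ be an $(n,k)$ linear code over $\mathrm{GF}(q^m)$ with rank covering radius $\rho$. Then $k=n-\rho$ if at least one of the following holds: $\rho\in\{0,1,n-1,n\}$; or $\rho(n-\rho)\le m+\log_q K_q$, where $K_q=\prod_{j=1}^\infty(1-q^{-j})$; or $\mathcal{C}$ is a generalized Gabidulin code; or $\mathcal{C}$ is an elementary linear subspace.
   Context: For $\mathbf{x}\in \mathrm{GF}(q^m)^n$, $\mathrm{rk}(\mathbf{x})$ is the maximum number of coordinates of $\mathbf{x}$ that are linearly independent over $\mathrm{GF}(q)$; the rank distance is $d_R(\mathbf{x},\mathbf{y})=\mathrm{rk}(\mathbf{x}-\mathbf{y})$. The rank covering radius of a code $C\subseteq \mathrm{GF}(q^m)^n$ is $\max_{\mathbf{x}\in\mathrm{GF}(q^m)^n}\min_{\mathbf{c}\in C} d_R(\mathbf{x},\mathbf{c})$. An $(n,k)$ linear code over $\mathrm{GF}(q^m)$ is a $k$-dimensional $\mathrm{GF}(q^m)$-subspace of $\mathrm{GF}(q^m)^n$. A generalized Gabidulin code of length $n\le m$ and dimension $k$ ($1\le k\le n$) is the linear code over $\mathrm{GF}(q^m)$ generated by the rows $(g_0^{q^{ai}},g_1^{q^{ai}},\ldots,g_{n-1}^{q^{ai}})$, $0\le i\le k-1$, where $g_0,\ldots,g_{n-1}\in\mathrm{GF}(q^m)$ are linearly independent over $\mathrm{GF}(q)$ and $a$ is a positive integer with $\gcd(a,m)=1$; such a code is $k$-dimensional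 with minimum rank distance $n-k+1$. An elementary linear subspace is a $\mathrm{GF}(q^m)$-linear subspace of $\mathrm{GF}(q^m)^n$ having a basis consisting of vectors in $\mathrm{GF}(q)^n$. *)

theory Defs
  imports "HOL-Analysis.Analysis" "HOL-Number_Theory.Prime_Powers"
begin

text \<open>
  The field GF(q^m) is a type of sorts field and finite with q^m elements, and GF(q) is a subset
  \<open>K\<close> of it that is a subfield with q elements. The space GF(q^m)^n is the type \<open>'a ^ 'n\<close> with
  n = \<open>CARD('n)\<close>; subspaces, spans and dimensions over GF(q^m) are those of the interpretation
  \<open>vec\<close> of the vector space locale.
\<close>

definition subfield_set :: "'a::field set \<Rightarrow> bool" where
  "subfield_set K \<longleftrightarrow> 0 \<in> K \<and> 1 \<in> K \<and>
     (\<forall>x\<in>K. \<forall>y\<in>K. x + y \<in> K \<and> x * y \<in> K) \<and>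
     (\<forall>x\<in>K. - x \<in> K \<and> inverse x \<in> K)"

text \<open>
  Independence over \<open>K\<close> of the family of coordinates of \<open>x\<close> with index in \<open>S\<close>; being a family,
  it is dependent if two of its members coincide.
\<close>

definition coords_indep :: "'a::field set \<Rightarrow> 'a ^ 'n \<Rightarrow> 'n::finite set \<Rightarrow> bool" where
  "coords_indep K x S \<longleftrightarrow>
     (\<forall>c. (\<forall>i\<in>S. c i \<in> K) \<and> (\<Sum>i\<in>S. c i * x $ i) = 0 \<longrightarrow> (\<forall>i\<in>S. c i = 0))"

definition rk :: "'a::field set \<Rightarrow> 'a ^ 'n::finite \<Rightarrow> nat" where
  "rk K x = Max {card S | S. coords_indep K x S}"

definition rank_dist :: "'a::field set \<Rightarrow> 'a ^ 'n::finite \<Rightarrow> 'a ^ 'n \<Rightarrow> nat" where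
  "rank_dist K x y = rk K (x - y)"

definition rank_covering_radius :: "'a::{field,finite} set \<Rightarrow> ('a ^ 'n::finite) set \<Rightarrow> nat" where
  "rank_covering_radius K C = (MAX x\<in>UNIV. MIN c\<in>C. rank_dist K x c)"

definition linear_code :: "nat \<Rightarrow> ('a::field ^ 'n::finite) set \<Rightarrow> bool" where
  "linear_code k C \<longleftrightarrow> vec.subspace C \<and> vec.dim C = k"

definition generalized_gabidulin_code ::
    "nat \<Rightarrow> nat \<Rightarrow> 'a::field set \<Rightarrow> ('a ^ 'n::finite) set \<Rightarrow> bool" where
  "generalized_gabidulin_code q m K C \<longleftrightarrow> CARD('n) \<le> m \<and>
     (\<exists>k a (g :: 'a ^ 'n). 1 \<le> k \<and> k \<le> CARD('n) \<and> 0 < a \<and> coprime a m \<and>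
        coords_indep K g UNIV \<and>
        C = vec.span {(\<chi> j. g $ j ^ (q ^ (a * i))) | i. i < k})"

definition elementary_linear_subspace ::
    "'a::field set \<Rightarrow> ('a ^ 'n::finite) set \<Rightarrow> bool" where
  "elementary_linear_subspace K C \<longleftrightarrow>
     (\<exists>B. (\<forall>b\<in>B. \<forall>i. b $ i \<in> K) \<and> vec.independent B \<and> vec.span B = C)"

text \<open>The product over j from 1 to infinity of 1 - q^(-j); \<open>prodinf\<close> indexes from 0.\<close>

definition K_const :: "nat \<Rightarrow> real" where
  "K_const q = (\<Prod>j. 1 - 1 / real q ^ Suc j)"

end

theory Submission
  imports Defs
begin

text \<open>
  The bound \<open>\<rho> \<le> n - k\<close> holds for every linear code: extending a basis of the code by unit
  vectors shows that every vector is congruent modulo the code to one supported on n - k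
  coordinates. For the converse, a vector has rank at most \<open>\<rho>\<close> iff its coordinates lie in a
  \<open>\<rho>\<close>-dimensional GF(q)-subspace of GF(q^m), so a ball of radius \<open>\<rho>\<close> has at most
  [m choose \<open>\<rho>\<close>]_q q^(\<open>\<rho>\<close>n) elements. Sphere covering then forces n - k < \<open>\<rho>\<close> + 1 when \<open>\<rho>\<close> is 0 or 1
  and under the numerical condition. For an elementary code with basis \<open>B\<close>, if g has GF(q)-independent
  coordinates and g - c has rank r, the coordinates of g lie in a space of dimension r + |B|, whence
  n \<open>\<le>\<close> r + k; the case k = 0 also settles \<open>\<rho>\<close> = n - 1. For a Gabidulin code, the next row
  of the generator matrix is at distance at least n - k from the code, because a skew polynomial of degree k in
  the automorphism x \<open>\<mapsto>\<close> x^(q^a) has at most q^k zeros.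
\<close>

section \<open>Subspaces over the small field and the rank\<close>

lemma subfield_power_card:
  assumes K: "subfield_set K" "finite K" and x: "x \<in> K"
  shows "x ^ card K = x"
proof (cases "x = 0")
  case True
  have "card K > 0" using assms by (auto simp: card_gt_0_iff)
  with True show ?thesis by simp
next
  case False
  have 0: "0 \<in> K" using K by (simp add: subfield_set_def)
  have pos: "card K > 0" using assms by (auto simp: card_gt_0_iff)
  have "x * (\<Prod>y\<in>K - {0}. x * y) = x * x ^ (card K - 1) * \<Prod>(K - {0})"
    using K 0 by (simp add: prod.distrib mult_ac card_Diff_singleton)
  also have "x * x ^ (card K - 1) = x ^ card K"
    using pos by (metis Suc_diff_1 power_Suc)
  \<comment> \<open>Multiplication by the nonzero \<open>x\<close> permutes \<open>K - {0}\<close>,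
    so the product of all nonzero elements can be cancelled.\<close>
  also have "(\<Prod>y\<in>K - {0}. x * y) = (\<Prod>y\<in>K - {0}. y)"
    by (rule prod.reindex_bij_witness[of _ "\<lambda>y. inverse x * y" "\<lambda>y. x * y"])
       (use False x K in \<open>auto simp: subfield_set_def\<close>)
  finally show ?thesis using K by simp
qed

text \<open>Translation by 1 permutes \<open>K\<close>, so the sum over \<open>K\<close> is
  unchanged when \<open>card K\<close> copies of 1 are added to it.\<close>

lemma subfield_of_nat_card:
  fixes K :: "'a::field set"
  assumes K: "subfield_set K"
  shows "of_nat (card K) = (0::'a)"
proof -
  have "(\<Sum>y\<in>K. y + 1) = (\<Sum>y\<in>K. y)"
    by (rule sum.reindex_bij_witness[of _ "\<lambda>y. y - 1" "\<lambda>y. y + 1"])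
       (use K in \<open>auto simp: subfield_set_def simp flip: add_uminus_conv_diff\<close>)
  then show ?thesis by (simp add: sum.distrib)
qed

text \<open>The characteristic divides \<open>card K\<close>, and a prime power has only one prime
  divisor. This is what later makes raising to a power of q additive.\<close>

lemma subfield_card_eq_CHAR_power:
  fixes K :: "'a::{field,finite} set"
  assumes "subfield_set K" and "primepow (card K)"
  shows "prime CHAR('a)" and "\<exists>s. card K = CHAR('a) ^ s"
proof -
  show pr: "prime CHAR('a)"
    by (rule prime_CHAR_semidom) (rule finite_imp_CHAR_pos, simp)
  have dvd: "CHAR('a) dvd card K"
    using subfield_of_nat_card[OF assms(1)] by (simp add: of_nat_eq_0_iff_char_dvd)
  obtain p s where ps: "prime p" "card K = p ^ s"
    using assms(2) by (auto simp: primepow_def)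
  have "CHAR('a) = p"
    using dvd pr ps by (metis prime_dvd_power primes_dvd_imp_eq)
  with ps show "\<exists>s. card K = CHAR('a) ^ s" by blast
qed

section \<open>The extension of \<open>K\<close> and its \<open>K\<close>-subspaces\<close>

locale finite_field_extension =
  fixes K :: "'a::{field,finite} set" and q m :: nat
  assumes subfield: "subfield_set K" and card_K: "card K = q" and card_UNIV: "CARD('a) = q ^ m"
begin

lemma K_closed [intro]:
  "0 \<in> K" "1 \<in> K"
  "x \<in> K \<Longrightarrow> y \<in> K \<Longrightarrow> x + y \<in> K"
  "x \<in> K \<Longrightarrow> y \<in> K \<Longrightarrow> x * y \<in> K"
  "x \<in> K \<Longrightarrow> y \<in> K \<Longrightarrow> x - y \<in> K"
  "x \<in> K \<Longrightarrow> - x \<in> K"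
  "x \<in> K \<Longrightarrow> inverse x \<in> K"
  using subfield unfolding subfield_set_def by (auto simp flip: add_uminus_conv_diff)

lemma q_gt_1: "q > 1"
proof -
  have "card {0::'a, 1} \<le> card K" by (rule card_mono) auto
  then show ?thesis by (simp add: card_K)
qed

text \<open>Dimension over \<open>K\<close> is never introduced: a subspace of dimension d is
  recognised by having \<open>q ^ d\<close> elements.\<close>

definition Ksub :: "'a set \<Rightarrow> bool" where
  "Ksub U \<longleftrightarrow> 0 \<in> U \<and> (\<forall>x\<in>U. \<forall>y\<in>U. x + y \<in> U) \<and> (\<forall>c\<in>K. \<forall>x\<in>U. c * x \<in> U)"

lemma Ksub_closed:
  assumes "Ksub U"
  shows "0 \<in> U"
    and "x \<in> U \<Longrightarrow> y \<in> U \<Longrightarrow> x + y \<in> U"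
    and "c \<in> K \<Longrightarrow> x \<in> U \<Longrightarrow> c * x \<in> U"
    and "x \<in> U \<Longrightarrow> y \<in> U \<Longrightarrow> x - y \<in> U"
proof -
  show "0 \<in> U" using assms by (simp add: Ksub_def)
  have add: "x \<in> U \<Longrightarrow> y \<in> U \<Longrightarrow> x + y \<in> U" for x y
    using assms by (simp add: Ksub_def)
  then show "x \<in> U \<Longrightarrow> y \<in> U \<Longrightarrow> x + y \<in> U" .
  have scale: "c \<in> K \<Longrightarrow> x \<in> U \<Longrightarrow> c * x \<in> U" for c x
    using assms by (simp add: Ksub_def)
  then show "c \<in> K \<Longrightarrow> x \<in> U \<Longrightarrow> c * x \<in> U" .
  assume "x \<in> U" "y \<in> U"
  then have "x + (-1) * y \<in> U" using K_closed by (intro add scale) auto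
  then show "x - y \<in> U" by simp
qed

definition adjoin :: "'a set \<Rightarrow> 'a \<Rightarrow> 'a set" where
  "adjoin U v = (\<lambda>(u, c). u + c * v) ` (U \<times> K)"

lemma adjoinI: "u \<in> U \<Longrightarrow> c \<in> K \<Longrightarrow> u + c * v \<in> adjoin U v"
  unfolding adjoin_def by force

lemma adjoinE:
  assumes "x \<in> adjoin U v"
  obtains u c where "u \<in> U" "c \<in> K" "x = u + c * v"
  using assms unfolding adjoin_def by auto

lemma Ksub_adjoin:
  assumes U: "Ksub U"
  shows "Ksub (adjoin U v)"
proof -
  have "0 + 0 * v \<in> adjoin U v"
    using U by (intro adjoinI) (auto simp: Ksub_closed)
  moreover have "x + y \<in> adjoin U v" if "x \<in> adjoin U v" "y \<in> adjoin U v" for x y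
  proof -
    obtain u c where x: "u \<in> U" "c \<in> K" "x = u + c * v"
      using \<open>x \<in> adjoin U v\<close> by (rule adjoinE)
    obtain u' c' where y: "u' \<in> U" "c' \<in> K" "y = u' + c' * v"
      using \<open>y \<in> adjoin U v\<close> by (rule adjoinE)
    have "(u + u') + (c + c') * v \<in> adjoin U v"
      using U x y by (intro adjoinI) (auto simp: Ksub_closed)
    then show ?thesis by (simp add: x y algebra_simps)
  qed
  moreover have "d * x \<in> adjoin U v" if "d \<in> K" "x \<in> adjoin U v" for d x
  proof -
    obtain u c where x: "u \<in> U" "c \<in> K" "x = u + c * v"
      using \<open>x \<in> adjoin U v\<close> by (rule adjoinE)
    have "(d * u) + (d * c) * v \<in> adjoin U v"
      using U x that by (intro adjoinI) (auto simp: Ksub_closed)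
    then show ?thesis by (simp add: x algebra_simps)
  qed
  ultimately show ?thesis unfolding Ksub_def by simp
qed

lemma adjoin_subset:
  assumes "Ksub W" "U \<subseteq> W" "v \<in> W"
  shows "adjoin U v \<subseteq> W"
  using assms by (auto elim!: adjoinE simp: Ksub_closed subset_iff)

lemma adjoin_superset: "U \<subseteq> adjoin U v"
proof
  fix u assume "u \<in> U"
  then have "u + 0 * v \<in> adjoin U v" by (intro adjoinI) auto
  then show "u \<in> adjoin U v" by simp
qed

lemma card_adjoin:
  assumes U: "Ksub U" and v: "v \<notin> U"
  shows "card (adjoin U v) = q * card U"
proof -
  have "inj_on (\<lambda>(u, c). u + c * v) (U \<times> K)"
  proof (rule inj_onI, clarify)
    fix u c u' c'
    assume *: "u \<in> U" "c \<in> K" "u' \<in> U" "c' \<in> K" "u + c * v = u' + c' * v"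
    have "c = c'"
    proof (rule ccontr)
      assume "c \<noteq> c'"
      then have "v = inverse (c - c') * (u' - u)"
        using *(5) by (simp add: field_simps)
      moreover have "inverse (c - c') * (u' - u) \<in> U"
        using * by (intro Ksub_closed[OF U]) auto
      ultimately show False using v by simp
    qed
    with * show "u = u' \<and> c = c'" by simp
  qed
  then show ?thesis unfolding adjoin_def by (simp add: card_image card_cartesian_product card_K)
qed

section \<open>Independent lists and their number\<close>

fun lspan :: "'a list \<Rightarrow> 'a set" where
  "lspan [] = {0}"
| "lspan (v # vs) = adjoin (lspan vs) v"

text \<open>The recursive form, each head lying outside the span of its tail, allows such lists to
  be counted one entry at a time.\<close>

fun lindep :: "'a list \<Rightarrow> bool" where
  "lindep [] \<longleftrightarrow> True"
| "lindep (v # vs) \<longleftrightarrow> v \<notin> lspan vs \<and> lindep vs"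

lemma Ksub_lspan: "Ksub (lspan vs)"
proof (induction vs)
  case Nil
  show ?case by (simp add: Ksub_def)
qed (simp add: Ksub_adjoin)

lemma card_lspan: "lindep vs \<Longrightarrow> card (lspan vs) = q ^ length vs"
  by (induction vs) (auto simp: card_adjoin Ksub_lspan)

lemma lspan_subset:
  assumes "Ksub W"
  shows "set vs \<subseteq> W \<Longrightarrow> lspan vs \<subseteq> W"
proof (induction vs)
  case Nil
  then show ?case using Ksub_closed(1)[OF assms] by simp
next
  case (Cons v vs)
  then show ?case using adjoin_subset[OF assms, of "lspan vs" v] by simp
qed

definition indep_lists :: "nat \<Rightarrow> 'a set \<Rightarrow> 'a list set" where
  "indep_lists r W = {vs. length vs = r \<and> set vs \<subseteq> W \<and> lindep vs}"

lemma finite_indep_lists: "finite (indep_lists r W)"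
  by (rule finite_subset[OF _ finite_lists_length_eq[of UNIV r]]) (auto simp: indep_lists_def)

text \<open>An independent tail of length i spans \<open>q ^ i\<close> elements, all of them
  forbidden for the next head. If \<open>r > d\<close>, the factor at \<open>i = d\<close> vanishes,
  in agreement with there being no such list.\<close>

lemma card_indep_lists:
  assumes W: "Ksub W" and card: "card W = q ^ d"
  shows "card (indep_lists r W) = (\<Prod>i<r. q ^ d - q ^ i)"
proof (induction r)
  case 0
  have "indep_lists 0 W = {[]}" by (auto simp: indep_lists_def)
  then show ?case by simp
next
  case (Suc r)
  have eq: "indep_lists (Suc r) W = (\<lambda>(vs, v). v # vs) ` (SIGMA vs:indep_lists r W. W - lspan vs)"
    by (auto simp: indep_lists_def length_Suc_conv image_iff)
  have inj: "inj_on (\<lambda>(vs, v). v # vs) (SIGMA vs:indep_lists r W. W - lspan vs)"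
    by (auto simp: inj_on_def)
  have "card (W - lspan vs) = q ^ d - q ^ r" if "vs \<in> indep_lists r W" for vs
    using that lspan_subset[OF W] card_lspan card
    by (subst card_Diff_subset) (auto simp: indep_lists_def)
  then have "card (indep_lists (Suc r) W) = card (indep_lists r W) * (q ^ d - q ^ r)"
    unfolding eq using inj finite_indep_lists by (simp add: card_image card_SigmaI)
  then show ?case by (simp add: Suc.IH)
qed

text \<open>Adjoining an element outside a proper subspace multiplies its size by \<open>q\<close>.
  This pads a space of dimension the rank of a vector to a prescribed dimension.\<close>

lemma Ksub_extend:
  assumes "Ksub U" "card U = q ^ r" "r \<le> d" "d \<le> m"
  shows "\<exists>W. Ksub W \<and> U \<subseteq> W \<and> card W = q ^ d"
  using assms(3,4)
proof (induction d rule: dec_induct)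
  case base
  then show ?case using assms by blast
next
  case (step d)
  then obtain W where W: "Ksub W" "U \<subseteq> W" "card W = q ^ d" by auto
  have "card W < CARD('a)"
    using W step q_gt_1 card_UNIV by (simp add: power_strict_increasing)
  then obtain v where "v \<notin> W" by (metis UNIV_eq_I less_irrefl)
  then have "card (adjoin W v) = q ^ Suc d" using W by (simp add: card_adjoin)
  then show ?case using W Ksub_adjoin adjoin_superset by blast
qed

text \<open>Coefficient functions are pinned down outside \<open>I\<close>, so for finite
  \<open>I\<close> there are exactly \<open>q ^ card I\<close> of them. Counting them bounds the
  size of the span, and gives it exactly when the family is independent.\<close>

definition kspan :: "'i set \<Rightarrow> ('i \<Rightarrow> 'a) \<Rightarrow> 'a set" where
  "kspan I v = (\<lambda>c. \<Sum>i\<in>I. c i * v i) ` (I \<rightarrow>\<^sub>E K)"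

lemma kspanI:
  assumes "\<And>i. i \<in> I \<Longrightarrow> c i \<in> K"
  shows "(\<Sum>i\<in>I. c i * v i) \<in> kspan I v"
proof -
  have "(\<Sum>i\<in>I. c i * v i) = (\<Sum>i\<in>I. restrict c I i * v i)" by (rule sum.cong) auto
  then show ?thesis unfolding kspan_def using assms by (intro image_eqI[of _ _ "restrict c I"]) auto
qed

lemma kspanE:
  assumes "x \<in> kspan I v"
  obtains c where "\<forall>i\<in>I. c i \<in> K" "x = (\<Sum>i\<in>I. c i * v i)"
proof -
  from assms obtain c where "c \<in> I \<rightarrow>\<^sub>E K" "x = (\<Sum>i\<in>I. c i * v i)"
    unfolding kspan_def by blast
  then show thesis by (intro that[of c]) (auto simp: PiE_mem)
qed

lemma Ksub_kspan: "Ksub (kspan I v)"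
proof -
  have "(\<Sum>i\<in>I. 0 * v i) \<in> kspan I v" by (intro kspanI) auto
  moreover have "x + y \<in> kspan I v" if x: "x \<in> kspan I v" and y: "y \<in> kspan I v" for x y
  proof -
    obtain c where c: "\<forall>i\<in>I. c i \<in> K" "x = (\<Sum>i\<in>I. c i * v i)" using x by (rule kspanE)
    obtain d where d: "\<forall>i\<in>I. d i \<in> K" "y = (\<Sum>i\<in>I. d i * v i)" using y by (rule kspanE)
    have "(\<Sum>i\<in>I. (c i + d i) * v i) \<in> kspan I v" using c d by (intro kspanI) auto
    then show ?thesis by (simp add: c d sum.distrib algebra_simps)
  qed
  moreover have "e * x \<in> kspan I v" if e: "e \<in> K" and x: "x \<in> kspan I v" for e x
  proof -
    obtain c where c: "\<forall>i\<in>I. c i \<in> K" "x = (\<Sum>i\<in>I. c i * v i)" using x by (rule kspanE)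
    have "(\<Sum>i\<in>I. (e * c i) * v i) \<in> kspan I v" using c e by (intro kspanI) auto
    then show ?thesis by (simp add: c sum_distrib_left mult.assoc)
  qed
  ultimately show ?thesis by (simp add: Ksub_def)
qed

lemma card_kspan_le:
  assumes "finite I"
  shows "card (kspan I v) \<le> q ^ card I"
proof -
  have "card (kspan I v) \<le> card (I \<rightarrow>\<^sub>E K)"
    unfolding kspan_def using assms by (intro card_image_le finite_PiE) auto
  then show ?thesis by (simp add: card_PiE assms card_K)
qed

lemma card_kspan_coords:
  assumes "coords_indep K x S"
  shows "card (kspan S (($) x)) = q ^ card S"
proof -
  have "inj_on (\<lambda>c. \<Sum>i\<in>S. c i * x $ i) (S \<rightarrow>\<^sub>E K)"
  proof (rule inj_onI)
    fix c d assume cd: "c \<in> S \<rightarrow>\<^sub>E K" "d \<in> S \<rightarrow>\<^sub>E K"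
      and eq: "(\<Sum>i\<in>S. c i * x $ i) = (\<Sum>i\<in>S. d i * x $ i)"
    have "(\<Sum>i\<in>S. (c i - d i) * x $ i) = 0" by (simp add: left_diff_distrib sum_subtractf eq)
    moreover have "\<forall>i\<in>S. c i - d i \<in> K" using cd by auto
    ultimately have "\<forall>i\<in>S. c i - d i = 0"
      using spec[OF assms[unfolded coords_indep_def], of "\<lambda>i. c i - d i"] by blast
    then show "c = d" using cd by (intro PiE_ext) auto
  qed
  then show ?thesis unfolding kspan_def by (simp add: card_image card_PiE card_K)
qed

lemma mem_kspan:
  assumes "finite I" "i \<in> I"
  shows "v i \<in> kspan I v"
proof -
  have "(\<Sum>j\<in>I. (if j = i then 1 else 0) * v j) \<in> kspan I v" by (intro kspanI) auto
  also have "(\<Sum>j\<in>I. (if j = i then 1 else 0) * v j) = v i"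
    using assms by (simp add: if_distrib[of "\<lambda>c. c * v _"] sum.delta cong: if_cong)
  finally show ?thesis .
qed

section \<open>The rank and the subspaces containing all coordinates\<close>

lemma rk_set: "finite {card S | S. coords_indep K (x :: 'a ^ 'n::finite) S}"
  "{card S | S. coords_indep K x S} \<noteq> {}"
proof -
  show "finite {card S | S. coords_indep K x S}"
    by (rule finite_subset[of _ "card ` UNIV"]) auto
  have "coords_indep K x {}" by (simp add: coords_indep_def)
  then show "{card S | S. coords_indep K x S} \<noteq> {}" by blast
qed

text \<open>Take a largest independent set \<open>S\<close> of coordinates. A coordinate outside the
  span of \<open>S\<close> could be added to \<open>S\<close>, since a relation involving it could
  be solved for it; so that span contains every coordinate.\<close>

lemma rk_cover:
  fixes x :: "'a ^ 'n::finite"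
  shows "\<exists>U. Ksub U \<and> card U = q ^ rk K x \<and> (\<forall>i. x $ i \<in> U)"
proof -
  have "rk K x \<in> {card S | S. coords_indep K x S}"
    unfolding rk_def using rk_set by (rule Max_in)
  then obtain S where S: "coords_indep K x S" "rk K x = card S" by auto
  have max: "card T \<le> card S" if "coords_indep K x T" for T
  proof -
    have "card T \<le> rk K x" unfolding rk_def using rk_set(1) that by (intro Max_ge) auto
    then show ?thesis by (simp add: S)
  qed
  have "x $ i \<in> kspan S (($) x)" for i
  proof (rule ccontr)
    assume i: "x $ i \<notin> kspan S (($) x)"
    then have "i \<notin> S" using mem_kspan[of S i "($) x"] by auto
    have "coords_indep K x (insert i S)"
      unfolding coords_indep_def
    proof (intro allI impI)
      fix c assume c: "(\<forall>j\<in>insert i S. c j \<in> K) \<and> (\<Sum>j\<in>insert i S. c j * x $ j) = 0"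
      then have sum: "c i * x $ i + (\<Sum>j\<in>S. c j * x $ j) = 0" using \<open>i \<notin> S\<close> by simp
      have "c i = 0"
      proof (rule ccontr)
        assume nz: "c i \<noteq> 0"
        have "x $ i = (- inverse (c i)) * (\<Sum>j\<in>S. c j * x $ j)"
          using sum nz by (simp add: field_simps eq_neg_iff_add_eq_0)
        also have "\<dots> \<in> kspan S (($) x)"
          using c by (intro Ksub_closed(3)[OF Ksub_kspan] kspanI) auto
        finally show False using i by simp
      qed
      then show "\<forall>j\<in>insert i S. c j = 0"
        using sum c S(1) by (simp add: coords_indep_def)
    qed
    from max[OF this] \<open>i \<notin> S\<close> show False by simp
  qed
  then show ?thesis
    using card_kspan_coords[OF S(1)] Ksub_kspan[of S "($) x"] S(2) by (intro exI[of _ "kspan S (($) x)"]) simp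
qed

text \<open>An independent set of coordinates avoids zero coordinates: coefficient 1 there and 0
  elsewhere would be a nontrivial relation.\<close>

lemma rk_le_card_support:
  fixes x :: "'a ^ 'n::finite"
  assumes "\<And>i. i \<notin> T \<Longrightarrow> x $ i = 0"
  shows "rk K x \<le> card T"
proof -
  have "rk K x \<in> {card S | S. coords_indep K x S}"
    unfolding rk_def using rk_set by (rule Max_in)
  then obtain S where S: "coords_indep K x S" "rk K x = card S" by auto
  have "S \<subseteq> T"
  proof
    fix i assume i: "i \<in> S"
    show "i \<in> T"
    proof (rule ccontr)
      assume "i \<notin> T"
      then have "(\<Sum>j\<in>S. (if j = i then 1 else 0) * x $ j) = 0"
        using assms by (intro sum.neutral) auto
      moreover have "\<forall>j\<in>S. (if j = i then 1 else 0) \<in> K" by auto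
      ultimately have "\<forall>j\<in>S. (if j = i then 1 else 0) = (0::'a)"
        using spec[OF S(1)[unfolded coords_indep_def], of "\<lambda>j. if j = i then 1 else 0"] by blast
      with i show False by (metis zero_neq_one)
    qed
  qed
  then show ?thesis using S by (simp add: card_mono)
qed

end

section \<open>Rank covering radius and sphere covering\<close>

lemma rank_covering_radius_le:
  fixes C :: "('a::{field,finite} ^ 'n::finite) set"
  assumes "\<And>x. \<exists>c\<in>C. rk K (x - c) \<le> r"
  shows "rank_covering_radius K C \<le> r"
  unfolding rank_covering_radius_def
proof (rule Max.boundedI)
  fix a assume "a \<in> range (\<lambda>x. MIN c\<in>C. rank_dist K x c)"
  then obtain x where a: "a = (MIN c\<in>C. rank_dist K x c)" by blast
  obtain c where "c \<in> C" "rk K (x - c) \<le> r" using assms by blast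
  then show "a \<le> r" unfolding a by (intro Min.coboundedI[THEN order.trans, of _ "rank_dist K x c"])
    (auto simp: rank_dist_def)
qed auto

lemma rank_covering_radius_ge:
  fixes C :: "('a::{field,finite} ^ 'n::finite) set"
  assumes "C \<noteq> {}" and "\<And>c. c \<in> C \<Longrightarrow> r \<le> rk K (x - c)"
  shows "r \<le> rank_covering_radius K C"
proof -
  have "r \<le> (MIN c\<in>C. rank_dist K x c)"
    using assms by (intro Min.boundedI) (auto simp: rank_dist_def)
  also have "\<dots> \<le> rank_covering_radius K C"
    unfolding rank_covering_radius_def by (intro Max_ge) auto
  finally show ?thesis .
qed

lemma rank_covering_radius_attained:
  fixes C :: "('a::{field,finite} ^ 'n::finite) set"
  assumes "C \<noteq> {}"
  shows "\<exists>c\<in>C. rk K (x - c) \<le> rank_covering_radius K C"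
proof (rule ccontr)
  assume "\<not> ?thesis"
  then have "Suc (rank_covering_radius K C) \<le> rank_covering_radius K C"
    using assms by (intro rank_covering_radius_ge[where x = x]) (auto simp: not_le)
  then show False by simp
qed

text \<open>Serves in two ways: it bounds the code from above in the sphere covering argument, and
  it bounds the dimension from below once many elements of a code are known.\<close>

lemma card_subspace_le:
  fixes C :: "('a::{field,finite} ^ 'n::finite) set"
  assumes "vec.subspace C"
  shows "card C \<le> CARD('a) ^ vec.dim C"
proof -
  obtain B where B: "B \<subseteq> C" "vec.independent B" "C \<subseteq> vec.span B" "card B = vec.dim C"
    using vec.basis_exists by blast
  have "C = vec.span B"
    using B assms by (simp add: vec.span_minimal subset_antisym)
  also have "\<dots> = (\<lambda>u. \<Sum>v\<in>B. u v *s v) ` (B \<rightarrow>\<^sub>E UNIV)"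
  proof -
    have "(\<Sum>v\<in>B. u v *s v) = (\<Sum>v\<in>B. restrict u B v *s v)" for u :: "'a ^ 'n \<Rightarrow> 'a"
      by (rule sum.cong) auto
    moreover have "restrict u B \<in> B \<rightarrow>\<^sub>E UNIV" for u :: "'a ^ 'n \<Rightarrow> 'a" by simp
    ultimately show ?thesis unfolding vec.span_finite[OF finite[of B]] by blast
  qed
  finally have "card C = card ((\<lambda>u. \<Sum>v\<in>B. u v *s v) ` (B \<rightarrow>\<^sub>E UNIV))"
    by (rule arg_cong)
  also have "\<dots> \<le> card (B \<rightarrow>\<^sub>E (UNIV :: 'a set))"
    by (intro card_image_le finite_PiE) auto
  finally have "card C \<le> card (B \<rightarrow>\<^sub>E (UNIV :: 'a set))" .
  then show ?thesis using B(4) by (simp add: card_PiE)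
qed

lemma card_vecs_in:
  fixes U :: "'a::finite set"
  shows "card {x :: 'a ^ 'n::finite. \<forall>i. x $ i \<in> U} = card U ^ CARD('n)"
proof -
  have "{x :: 'a ^ 'n. \<forall>i. x $ i \<in> U} = vec_lambda ` (UNIV \<rightarrow>\<^sub>E U)"
    by (auto simp: image_iff intro!: bexI[of _ "vec_nth _"])
  moreover have "inj_on (vec_lambda :: _ \<Rightarrow> 'a ^ 'n) (UNIV \<rightarrow>\<^sub>E U)"
    by (auto simp: inj_on_def vec_lambda_inject)
  ultimately show ?thesis by (simp add: card_image card_PiE)
qed

section \<open>Rank balls and sphere covering\<close>

context finite_field_extension
begin

text \<open>A subspace containing the coordinates is padded to dimension exactly \<open>r\<close>;
  each of its ordered bases contributes. The padding makes the bound the same for all vectors of the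
  ball.\<close>

lemma rk_ball_cover:
  fixes x :: "'a ^ 'n::finite"
  assumes "rk K x \<le> r" "r \<le> m"
  shows "(\<Prod>i<r. q ^ r - q ^ i) \<le> card {vs \<in> indep_lists r UNIV. \<forall>i. x $ i \<in> lspan vs}"
proof -
  obtain U where U: "Ksub U" "card U = q ^ rk K x" "\<forall>i. x $ i \<in> U" using rk_cover by blast
  obtain W where W: "Ksub W" "U \<subseteq> W" "card W = q ^ r" using Ksub_extend[OF U(1,2) assms] by blast
  have "lspan vs = W" if "vs \<in> indep_lists r W" for vs
    using that lspan_subset[OF W(1)] card_lspan W(3)
    by (intro card_subset_eq) (auto simp: indep_lists_def)
  then have "indep_lists r W \<subseteq> {vs \<in> indep_lists r UNIV. \<forall>i. x $ i \<in> lspan vs}"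
    using U(3) W(2) by (auto simp: indep_lists_def)
  then have "card (indep_lists r W) \<le> card {vs \<in> indep_lists r UNIV. \<forall>i. x $ i \<in> lspan vs}"
    by (intro card_mono) (auto simp: finite_indep_lists)
  then show ?thesis by (simp add: card_indep_lists[OF W(1,3)])
qed

text \<open>Double counting of the pairs of a vector and an ordered basis of an r-dimensional
  \<open>K\<close>-subspace of the large field containing all its coordinates.\<close>

lemma card_rk_ball:
  assumes "r \<le> m"
  shows "card {x :: 'a ^ 'n::finite. rk K x \<le> r} * (\<Prod>i<r. q ^ r - q ^ i)
    \<le> (\<Prod>i<r. q ^ m - q ^ i) * q ^ (r * CARD('n))"
proof -
  let ?B = "{x :: 'a ^ 'n. rk K x \<le> r}" and ?L = "indep_lists r UNIV"
  have "card ?B * (\<Prod>i<r. q ^ r - q ^ i) \<le> (\<Sum>x\<in>?B. card {vs \<in> ?L. \<forall>i. x $ i \<in> lspan vs})"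
    using sum_mono[of ?B "\<lambda>_. \<Prod>i<r. q ^ r - q ^ i", OF rk_ball_cover[OF _ assms]] by simp
  also have "\<dots> \<le> (\<Sum>x\<in>UNIV. card {vs \<in> ?L. \<forall>i. (x :: 'a ^ 'n) $ i \<in> lspan vs})"
    by (rule sum_mono2) auto
  also have "\<dots> = (\<Sum>x\<in>UNIV. \<Sum>vs\<in>?L. if \<forall>i. (x :: 'a ^ 'n) $ i \<in> lspan vs then 1 else 0)"
    by (simp add: sum.If_cases finite_indep_lists Int_def)
  also have "\<dots> = (\<Sum>vs\<in>?L. \<Sum>x\<in>UNIV. if \<forall>i. (x :: 'a ^ 'n) $ i \<in> lspan vs then 1 else 0)"
    by (rule sum.swap)
  also have "\<dots> = (\<Sum>vs\<in>?L. card {x :: 'a ^ 'n. \<forall>i. x $ i \<in> lspan vs})"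
    by (simp add: sum.If_cases)
  also have "\<dots> = (\<Sum>vs\<in>?L. q ^ (r * CARD('n)))"
    by (rule sum.cong) (auto simp: card_vecs_in card_lspan indep_lists_def power_mult)
  also have "\<dots> = (\<Prod>i<r. q ^ m - q ^ i) * q ^ (r * CARD('n))"
    using card_indep_lists[of UNIV m r] card_UNIV by (simp add: Ksub_def)
  finally show ?thesis .
qed

text \<open>Balls around the codewords cover the space, so its size is at most that of the code
  times that of a ball. To avoid division, the Gaussian binomial in the ball bound appears as two
  products on opposite sides.\<close>

lemma sphere_covering:
  fixes C :: "('a ^ 'n::finite) set"
  assumes C: "vec.subspace C" and r: "r \<le> m"
    and cover: "\<And>x. \<exists>c\<in>C. rk K (x - c) \<le> r"
  shows "q ^ (m * (CARD('n) - vec.dim C)) * (\<Prod>i<r. q ^ r - q ^ i)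
    \<le> (\<Prod>i<r. q ^ m - q ^ i) * q ^ (r * CARD('n))"
proof -
  let ?B = "{x :: 'a ^ 'n. rk K x \<le> r}"
  have "UNIV = (\<lambda>(c, y). c + y) ` (C \<times> ?B)"
  proof -
    have "x \<in> (\<lambda>(c, y). c + y) ` (C \<times> ?B)" for x
    proof -
      obtain c where "c \<in> C" "rk K (x - c) \<le> r" using cover by blast
      then show ?thesis by (intro image_eqI[of _ _ "(c, x - c)"]) auto
    qed
    then show ?thesis by blast
  qed
  then have "CARD('a ^ 'n) = card ((\<lambda>(c, y). c + y) ` (C \<times> ?B))" by (rule arg_cong)
  also have "\<dots> \<le> card (C \<times> ?B)" by (intro card_image_le) simp
  also have "\<dots> \<le> q ^ (m * vec.dim C) * card ?B"
    using card_subspace_le[OF C] by (simp add: card_cartesian_product card_UNIV power_mult)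
  finally have "q ^ (m * CARD('n)) \<le> q ^ (m * vec.dim C) * card ?B"
    by (simp add: card_UNIV power_mult)
  \<comment> \<open>The exponent is split so that the size bound of the code cancels; the
    subtraction is exact because the dimension is at most \<open>CARD('n)\<close>.\<close>
  moreover have "m * CARD('n) = m * vec.dim C + m * (CARD('n) - vec.dim C)"
    using vec.dim_subset_UNIV[of C] by (simp add: vec.dimension_def card_cart_basis flip: distrib_left)
  ultimately have "q ^ (m * (CARD('n) - vec.dim C)) \<le> card ?B"
    using q_gt_1 by (simp add: power_add)
  then show ?thesis using card_rk_ball[OF r, where ?'n = 'n] by (meson mult_le_mono1 order.trans)
qed

section \<open>The codimension as a bound from above, and from below for elementary
  subspaces\<close>

lemma rank_covering_radius_le_codim:
  fixes C :: "('a ^ 'n::finite) set"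
  assumes C: "vec.subspace C"
  shows "rank_covering_radius K C \<le> CARD('n) - vec.dim C"
proof -
  obtain B where B: "B \<subseteq> C" "vec.independent B" "C \<subseteq> vec.span B" "card B = vec.dim C"
    using vec.basis_exists by blast
  \<comment> \<open>\<open>E\<close> completes the basis \<open>B\<close> of the code to a basis of
    the whole space, adding unit vectors only.\<close>
  obtain E where E: "B \<subseteq> E" "E \<subseteq> B \<union> cart_basis" "vec.independent E" "B \<union> cart_basis \<subseteq> vec.span E"
    using vec.maximal_independent_subset_extend[of B "B \<union> cart_basis"] B(2) by blast
  have "vec.span E = UNIV"
    using vec.span_mono[of cart_basis "vec.span E"] E(4) by (auto simp: vec.span_span)
  have "card E = CARD('n)"
    using vec.dim_span_eq_card_independent[OF E(3)] \<open>vec.span E = UNIV\<close>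
    by (simp add: vec.dim_UNIV card_cart_basis vec.dimension_def)
  \<comment> \<open>The positions of the added unit vectors. Subtracting from a vector its part
    along \<open>B\<close> leaves a vector supported on \<open>T\<close>.\<close>
  define T where "T = {i :: 'n. axis i 1 \<in> E - B}"
  have "card T = card (E - B)"
  proof (rule bij_betw_same_card[of "\<lambda>i. axis i 1"])
    show "bij_betw (\<lambda>i :: 'n. axis i (1::'a)) T (E - B)"
      using E(2) unfolding bij_betw_def T_def cart_basis_def
      by (auto simp: inj_on_def axis_eq_axis)
  qed
  then have T: "card T = CARD('n) - vec.dim C"
    using B(4) E(1) \<open>card E = CARD('n)\<close> by (simp add: card_Diff_subset)
  show ?thesis
  proof (rule rank_covering_radius_le)
    fix x :: "'a ^ 'n"
    obtain u where x: "x = (\<Sum>v\<in>E. u v *s v)"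
      using \<open>vec.span E = UNIV\<close> vec.span_finite[of E] by auto
    define c where "c = (\<Sum>v\<in>B. u v *s v)"
    have "c \<in> C" unfolding c_def
      using B(1) by (intro vec.subspace_sum[OF C] vec.subspace_scale[OF C]) auto
    moreover have "rk K (x - c) \<le> card T"
    proof (rule rk_le_card_support)
      fix i assume i: "i \<notin> T"
      have "x - c = (\<Sum>v\<in>E - B. u v *s v)"
        unfolding x c_def using E(1) by (simp add: sum_diff)
      moreover have "v $ i = 0" if v: "v \<in> E - B" for v
      proof -
        obtain j where "v = axis j 1" using v E(2) by (auto simp: cart_basis_def)
        with v i show ?thesis by (auto simp: T_def axis_def)
      qed
      ultimately show "(x - c) $ i = 0" by simp
    qed
    ultimately show "\<exists>c\<in>C. rk K (x - c) \<le> CARD('n) - vec.dim C" using T by auto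
  qed
qed

lemma elementary_covering_radius_ge:
  fixes C :: "('a ^ 'n::finite) set"
  assumes C: "elementary_linear_subspace K C" and nm: "CARD('n) \<le> m"
  shows "CARD('n) - vec.dim C \<le> rank_covering_radius K C"
proof -
  obtain B where B: "\<And>b i. b \<in> B \<Longrightarrow> b $ i \<in> K" "vec.independent B" "vec.span B = C"
    using C unfolding elementary_linear_subspace_def by blast
  have k: "card B = vec.dim C" using vec.dim_span_eq_card_independent[OF B(2)] B(3) by simp
  \<comment> \<open>The number of independent lists of length \<open>CARD('n)\<close> is positive
    because \<open>CARD('n) \<le> m\<close>. Such a list, arranged as a vector \<open>g\<close>,
    will be far from the code.\<close>
  have "(\<Prod>i<CARD('n). q ^ m - q ^ i) > 0"
    using q_gt_1 nm by (intro prod_pos) (auto intro: power_strict_increasing)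
  then have "indep_lists CARD('n) UNIV \<noteq> {}"
    using card_indep_lists[of UNIV m "CARD('n)"] card_UNIV by (metis Ksub_def UNIV_I card.empty less_irrefl)
  then obtain vs where vs: "length vs = CARD('n)" "lindep vs" by (auto simp: indep_lists_def)
  obtain f :: "'n \<Rightarrow> nat" where f: "bij_betw f UNIV {0..<CARD('n)}"
    using ex_bij_betw_finite_nat[of "UNIV :: 'n set"] by auto
  define g where "g = (\<chi> i. vs ! f i)"
  have range_g: "set vs \<subseteq> range (($) g)"
  proof
    fix v assume "v \<in> set vs"
    then obtain j where j: "j < CARD('n)" "v = vs ! j" by (metis in_set_conv_nth vs(1))
    then obtain i where "j = f i" using f unfolding bij_betw_def by (metis atLeastLessThan_iff imageE le0)
    then show "v \<in> range (($) g)" using j by (auto simp: g_def)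
  qed
  show ?thesis
  proof (rule rank_covering_radius_ge[where x = g])
    show "C \<noteq> {}" using B(3) vec.span_zero by blast
    fix c assume "c \<in> C"
    then obtain u where u: "c = (\<Sum>b\<in>B. u b *s b)" using B(3) vec.span_finite[of B] by auto
    obtain U where U: "Ksub U" "card U = q ^ rk K (g - c)" "\<forall>i. (g - c) $ i \<in> U"
      using rk_cover by blast
    \<comment> \<open>Basis entries lie in \<open>K\<close>, so the coordinates of \<open>c\<close>
      are \<open>K\<close>-combinations of the coefficients \<open>u b\<close>. Adding the space
      \<open>U\<close> around \<open>g - c\<close> gives a subspace \<open>W\<close> containing
      every coordinate of \<open>g\<close>.\<close>
    let ?V = "kspan B u"
    define W where "W = (\<lambda>(x, y). x + y) ` (U \<times> ?V)"
    have W: "Ksub W"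
      unfolding Ksub_def
    proof (intro conjI ballI)
      show "0 \<in> W"
        unfolding W_def using Ksub_closed(1)[OF U(1)] Ksub_closed(1)[OF Ksub_kspan]
        by (intro image_eqI[of _ _ "(0, 0)"]) auto
    next
      fix x y assume "x \<in> W" "y \<in> W"
      then obtain a b a' b' where *: "a \<in> U" "b \<in> ?V" "x = a + b" "a' \<in> U" "b' \<in> ?V" "y = a' + b'"
        unfolding W_def by auto
      then show "x + y \<in> W"
        unfolding W_def using Ksub_closed(2)[OF U(1)] Ksub_closed(2)[OF Ksub_kspan]
        by (intro image_eqI[of _ _ "(a + a', b + b')"]) auto
    next
      fix d x assume "d \<in> K" "x \<in> W"
      then obtain a b where *: "a \<in> U" "b \<in> ?V" "x = a + b"
        unfolding W_def by auto
      then show "d * x \<in> W"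
        unfolding W_def using \<open>d \<in> K\<close> Ksub_closed(3)[OF U(1)] Ksub_closed(3)[OF Ksub_kspan]
        by (intro image_eqI[of _ _ "(d * a, d * b)"]) (auto simp: distrib_left)
    qed
    have "g $ i \<in> W" for i
    proof -
      have "c $ i = (\<Sum>b\<in>B. b $ i * u b)" unfolding u by (simp add: mult.commute)
      also have "\<dots> \<in> ?V" using B(1) by (intro kspanI) auto
      finally show ?thesis
        unfolding W_def using U(3) by (intro image_eqI[of _ _ "((g - c) $ i, c $ i)"]) auto
    qed
    then have "lspan vs \<subseteq> W" using range_g by (intro lspan_subset[OF W]) auto
    then have "q ^ CARD('n) \<le> card W"
      using card_lspan[OF vs(2)] vs(1) card_mono[of W "lspan vs"] by simp
    also have "\<dots> \<le> card (U \<times> ?V)" unfolding W_def by (intro card_image_le) simp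
    also have "\<dots> \<le> q ^ rk K (g - c) * q ^ card B"
      using card_kspan_le[of B u] U(2) by (simp add: card_cartesian_product)
    also have "\<dots> = q ^ (rk K (g - c) + card B)" by (simp add: power_add)
    finally have "CARD('n) \<le> rk K (g - c) + card B"
      using q_gt_1 by (simp add: power_increasing_iff)
    then show "CARD('n) - vec.dim C \<le> rk K (g - c)" using k by simp
  qed
qed

end

section \<open>Skew polynomials and Gabidulin codes\<close>

text \<open>A nonempty fibre of an additive map is a translate of the kernel, and \<open>A\<close>
  is covered by the fibres over \<open>B\<close>.\<close>

lemma card_le_fibres:
  fixes f :: "'a::{ab_group_add,finite} \<Rightarrow> 'a"
  assumes add: "\<And>x y. f (x - y) = f x - f y"
    and ker: "card {z. f z = 0} \<le> t" and AB: "f ` A \<subseteq> B"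
  shows "card A \<le> card B * t"
proof -
  have fibre: "card {z. f z = w} \<le> t" for w
  proof (cases "\<exists>z. f z = w")
    case True
    then obtain z' where z': "f z' = w" by blast
    have "card {z. f z = w} \<le> card {z. f z = 0}"
      by (rule card_inj_on_le[where f = "\<lambda>z. z - z'"]) (auto simp: inj_on_def add z')
    with ker show ?thesis by simp
  qed simp
  have "card A \<le> card (\<Union>w\<in>B. {z. f z = w})"
    using AB by (intro card_mono) auto
  also have "\<dots> \<le> (\<Sum>w\<in>B. card {z. f z = w})" by (rule card_UN_le) simp
  also have "\<dots> \<le> card B * t" using sum_bounded_above[of B, OF fibre] by simp
  finally show ?thesis .
qed

text \<open>The combinations form a subspace containing every \<open>v i\<close>. Indexing
  coefficients by \<open>i\<close> avoids having to know beforehand that the vectors are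
  distinct.\<close>

lemma span_family_obtain:
  fixes v :: "nat \<Rightarrow> 'a::field ^ 'n::finite"
  assumes "x \<in> vec.span {v i | i. i < k}"
  obtains u where "x = (\<Sum>i<k. u i *s v i)"
proof -
  let ?S = "range (\<lambda>u. \<Sum>i<k. u i *s v i)"
  have "vec.subspace ?S"
  proof (rule vec.subspaceI)
    show "0 \<in> ?S" by (rule image_eqI[of _ _ "\<lambda>_. 0"]) auto
  next
    fix x y assume "x \<in> ?S" "y \<in> ?S"
    then obtain a b where "x = (\<Sum>i<k. a i *s v i)" "y = (\<Sum>i<k. b i *s v i)" by blast
    then show "x + y \<in> ?S"
      by (intro image_eqI[of _ _ "\<lambda>i. a i + b i"]) (auto simp: vec.scale_left_distrib sum.distrib)
  next
    fix c x assume "x \<in> ?S"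
    then obtain a where "x = (\<Sum>i<k. a i *s v i)" by blast
    then show "c *s x \<in> ?S"
      by (intro image_eqI[of _ _ "\<lambda>i. c * a i"]) (auto simp: vec.scale_sum_right)
  qed
  moreover have "{v i | i. i < k} \<subseteq> ?S"
  proof clarify
    fix i assume i: "i < k"
    have "v i = (\<Sum>j<k. if j = i then v j else 0)"
      using i by (simp add: sum.delta')
    also have "\<dots> = (\<Sum>j<k. (if j = i then 1 else 0) *s v j)"
      by (rule sum.cong) auto
    finally show "v i \<in> ?S" by (intro image_eqI[of _ _ "\<lambda>j. if j = i then 1 else 0"]) simp_all
  qed
  ultimately have "vec.span {v i | i. i < k} \<subseteq> ?S" by (intro vec.span_minimal)
  with assms that show thesis by blast
qed

context finite_field_extension
begin

section \<open>Skew polynomials in an endomorphism with at most \<open>q\<close> fixed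
  points\<close>

context
  fixes \<sigma> :: "'a \<Rightarrow> 'a"
  assumes \<sigma>_diff: "\<And>x y. \<sigma> (x - y) = \<sigma> x - \<sigma> y"
    and \<sigma>_mult: "\<And>x y. \<sigma> (x * y) = \<sigma> x * \<sigma> y"
    and \<sigma>_1: "\<sigma> 1 = 1"
    and \<sigma>_fix: "card {x. \<sigma> x = x} \<le> q"
begin

lemma \<sigma>_pow_diff: "(\<sigma> ^^ i) (x - y) = (\<sigma> ^^ i) x - (\<sigma> ^^ i) y"
  by (induction i) (auto simp: \<sigma>_diff)

lemma \<sigma>_pow_mult: "(\<sigma> ^^ i) (x * y) = (\<sigma> ^^ i) x * (\<sigma> ^^ i) y"
  by (induction i) (auto simp: \<sigma>_mult)

lemma \<sigma>_pow_0: "(\<sigma> ^^ i) 0 = 0"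
  using \<sigma>_pow_diff[of i 0 0] by simp

text \<open>Right division by \<open>\<sigma> - c\<close> in the skew polynomial ring.\<close>

lemma skew_division:
  "\<exists>M r. (\<forall>z. (\<Sum>i\<le>k. l i * (\<sigma> ^^ i) z) = (\<Sum>i<k. M i * (\<sigma> ^^ i) (\<sigma> z - c * z)) + r * z)
    \<and> (0 < k \<longrightarrow> M (k - 1) = l k)"
proof (induction k arbitrary: l)
  case 0
  show ?case by (intro exI[of _ "\<lambda>_. 0"] exI[of _ "l 0"]) simp
next
  case (Suc k)
  \<comment> \<open>Replacing the top power by \<open>\<sigma> - c\<close> followed by
    \<open>\<sigma> ^^ k\<close> leaves a term of degree \<open>k\<close> with coefficient
    \<open>l (Suc k) * (\<sigma> ^^ k) c\<close>, absorbed here.\<close>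
  define l' where "l' = l(k := l k + l (Suc k) * (\<sigma> ^^ k) c)"
  obtain M r where M: "\<And>z. (\<Sum>i\<le>k. l' i * (\<sigma> ^^ i) z) = (\<Sum>i<k. M i * (\<sigma> ^^ i) (\<sigma> z - c * z)) + r * z"
    using Suc.IH[of l'] by blast
  have "(\<Sum>i\<le>Suc k. l i * (\<sigma> ^^ i) z)
    = (\<Sum>i<Suc k. (M(k := l (Suc k))) i * (\<sigma> ^^ i) (\<sigma> z - c * z)) + r * z" for z
  proof -
    have "(\<Sum>i\<le>k. l' i * (\<sigma> ^^ i) z) = (\<Sum>i<k. l i * (\<sigma> ^^ i) z) + l' k * (\<sigma> ^^ k) z"
      by (simp add: l'_def flip: lessThan_Suc_atMost)
    moreover have "(\<Sum>i\<le>k. l i * (\<sigma> ^^ i) z) = (\<Sum>i<k. l i * (\<sigma> ^^ i) z) + l k * (\<sigma> ^^ k) z"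
      by (simp flip: lessThan_Suc_atMost)
    moreover have "l (Suc k) * (\<sigma> ^^ Suc k) z
      = l (Suc k) * (\<sigma> ^^ k) (\<sigma> z - c * z) + l (Suc k) * (\<sigma> ^^ k) c * (\<sigma> ^^ k) z"
      by (simp add: \<sigma>_pow_diff \<sigma>_pow_mult funpow_swap1 algebra_simps)
    moreover have "l' k = l k + l (Suc k) * (\<sigma> ^^ k) c" by (simp add: l'_def)
    moreover have "(\<Sum>i\<le>Suc k. l i * (\<sigma> ^^ i) z) = (\<Sum>i\<le>k. l i * (\<sigma> ^^ i) z) + l (Suc k) * (\<sigma> ^^ Suc k) z"
      by (simp del: funpow.simps)
    moreover have "(\<Sum>i<Suc k. (M(k := l (Suc k))) i * (\<sigma> ^^ i) (\<sigma> z - c * z))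
      = (\<Sum>i<k. M i * (\<sigma> ^^ i) (\<sigma> z - c * z)) + l (Suc k) * (\<sigma> ^^ k) (\<sigma> z - c * z)"
      by simp
    ultimately show ?thesis using M[of z] by algebra
  qed
  then show ?case by (intro exI[of _ "M(k := l (Suc k))"] exI[of _ r]) simp
qed

text \<open>A zero \<open>z0 \<noteq> 0\<close> makes \<open>\<sigma> - c\<close> with
  \<open>c = \<sigma> z0 / z0\<close> a right factor: at \<open>z0\<close> the quotient part
  vanishes, so the remainder does too. Division by \<open>z0\<close> sends the kernel of this factor
  into the fixed points of \<open>\<sigma>\<close>, so it has at most \<open>q\<close> elements. The
  quotient keeps the leading coefficient and falls under the induction hypothesis.\<close>

lemma card_skew_kernel:
  assumes "l k \<noteq> 0"
  shows "card {z. (\<Sum>i\<le>k. l i * (\<sigma> ^^ i) z) = 0} \<le> q ^ k"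
  using assms
proof (induction k arbitrary: l)
  case 0
  then have "{z. (\<Sum>i\<le>0. l i * (\<sigma> ^^ i) z) = 0} = {0}" by auto
  then show ?case by simp
next
  case (Suc k)
  let ?ker = "{z. (\<Sum>i\<le>Suc k. l i * (\<sigma> ^^ i) z) = 0}"
  show ?case
  proof (cases "?ker \<subseteq> {0}")
    case True
    then have "card ?ker \<le> 1" using card_mono[of "{0::'a}"] by simp
    also have "\<dots> \<le> q ^ Suc k" using q_gt_1 by (intro one_le_power) simp
    finally show ?thesis .
  next
    case False
    then obtain z0 where z0: "z0 \<noteq> 0" "z0 \<in> ?ker" by blast
    define c where "c = \<sigma> z0 / z0"
    have c: "\<sigma> z0 - c * z0 = 0" using z0 by (simp add: c_def)
    obtain M r where M: "\<And>z. (\<Sum>i\<le>Suc k. l i * (\<sigma> ^^ i) z)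
        = (\<Sum>i<Suc k. M i * (\<sigma> ^^ i) (\<sigma> z - c * z)) + r * z" "M k = l (Suc k)"
      using skew_division[where k = "Suc k" and l = l and c = c] by auto
    have "r * z0 = 0" using M(1)[of z0] z0 by (simp add: c \<sigma>_pow_0 del: sum.atMost_Suc)
    then have "r = 0" using z0 by simp
    have "card ?ker \<le> card {w. (\<Sum>i\<le>k. M i * (\<sigma> ^^ i) w) = 0} * q"
    proof (rule card_le_fibres[where f = "\<lambda>z. \<sigma> z - c * z"])
      show "\<sigma> (x - y) - c * (x - y) = \<sigma> x - c * x - (\<sigma> y - c * y)" for x y
        by (simp add: \<sigma>_diff algebra_simps)
      have "card {z. \<sigma> z - c * z = 0} \<le> card {x. \<sigma> x = x}"
      proof (rule card_inj_on_le[where f = "\<lambda>z. z / z0"])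
        show "inj_on (\<lambda>z. z / z0) {z. \<sigma> z - c * z = 0}" using z0 by (simp add: inj_on_def)
        show "(\<lambda>z. z / z0) ` {z. \<sigma> z - c * z = 0} \<subseteq> {x. \<sigma> x = x}"
        proof clarify
          fix z assume z: "\<sigma> z - c * z = 0"
          have "\<sigma> z = \<sigma> (z / z0) * \<sigma> z0" using z0 by (simp flip: \<sigma>_mult)
          moreover have "\<sigma> z0 \<noteq> 0"
            using \<sigma>_mult[of z0 "inverse z0"] z0 \<sigma>_1 by auto
          ultimately show "\<sigma> (z / z0) = z / z0"
            using z z0 by (simp add: c_def field_simps)
        qed
      qed simp
      then show "card {z. \<sigma> z - c * z = 0} \<le> q" using \<sigma>_fix by simp
      show "(\<lambda>z. \<sigma> z - c * z) ` ?ker \<subseteq> {w. (\<Sum>i\<le>k. M i * (\<sigma> ^^ i) w) = 0}"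
        using M(1) \<open>r = 0\<close> by (auto simp flip: lessThan_Suc_atMost simp del: sum.lessThan_Suc)
    qed
    also have "\<dots> \<le> q ^ k * q" using Suc.IH[of M] M(2) Suc.prems by simp
    finally show ?thesis by (simp add: mult.commute)
  qed
qed

text \<open>The polynomial acts as a \<open>K\<close>-linear map with at most \<open>q ^ k\<close>
  zeros. It sends the \<open>q ^ CARD('n)\<close> elements spanned by the coordinates of
  \<open>g\<close> into a space of size \<open>q\<close> to the rank of the image vector.\<close>

lemma rk_skew_evaluation_ge:
  fixes g :: "'a ^ 'n::finite"
  assumes K: "\<And>c. c \<in> K \<Longrightarrow> \<sigma> c = c" and g: "coords_indep K g UNIV" and l: "l k \<noteq> 0"
  shows "CARD('n) - k \<le> rk K (\<chi> j. \<Sum>i\<le>k. l i * (\<sigma> ^^ i) (g $ j))"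
proof -
  define L where "L z = (\<Sum>i\<le>k. l i * (\<sigma> ^^ i) z)" for z
  have L_diff: "L (x - y) = L x - L y" for x y
    by (simp add: L_def \<sigma>_pow_diff right_diff_distrib sum_subtractf)
  have L_0: "L 0 = 0" using L_diff[of 0 0] by simp
  have L_add: "L (x + y) = L x + L y" for x y
    using L_diff[of "x + y" y] by simp
  have "(\<sigma> ^^ i) c = c" if "c \<in> K" for i c
    using that by (induction i) (auto simp: K)
  then have L_scale: "L (c * x) = c * L x" if "c \<in> K" for c x
    using that by (simp add: L_def \<sigma>_pow_mult sum_distrib_left mult.left_commute)
  let ?x = "(\<chi> j. L (g $ j)) :: 'a ^ 'n"
  obtain U where U: "Ksub U" "card U = q ^ rk K ?x" "\<And>j. ?x $ j \<in> U"
    using rk_cover[of ?x] by blast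
  have "L ` kspan UNIV (($) g) \<subseteq> U"
  proof clarify
    fix z assume "z \<in> kspan UNIV (($) g)"
    then obtain c where c: "\<forall>j\<in>UNIV. c j \<in> K" "z = (\<Sum>j\<in>UNIV. c j * g $ j)" by (rule kspanE)
    have "L (\<Sum>j\<in>J. c j * g $ j) \<in> U" for J
    proof (induction J rule: infinite_finite_induct)
      case (insert j J)
      then show ?case
        using c(1) U(3)[of j] by (simp add: L_add L_scale Ksub_closed[OF U(1)])
    qed (simp_all add: L_0 Ksub_closed[OF U(1)])
    then show "L z \<in> U" by (simp add: c)
  qed
  moreover have "card {z. L z = 0} \<le> q ^ k"
    unfolding L_def using l by (rule card_skew_kernel)
  ultimately have "q ^ CARD('n) \<le> card U * q ^ k"
    using card_le_fibres[of L, OF L_diff] card_kspan_coords[OF g] by metis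
  then have "q ^ CARD('n) \<le> q ^ (rk K ?x + k)" by (simp add: U(2) power_add)
  then have "CARD('n) \<le> rk K ?x + k" using q_gt_1 by (simp add: power_increasing_iff)
  then show ?thesis by (simp add: L_def)
qed

text \<open>The rank bound is used twice: for the distance from \<open>v k\<close> to the code, and
  for the independence of the generators, which gives \<open>k \<le> vec.dim C\<close>.\<close>

lemma skew_span_covering_radius_ge:
  fixes g :: "'a ^ 'n::finite"
  assumes K: "\<And>c. c \<in> K \<Longrightarrow> \<sigma> c = c" and g: "coords_indep K g UNIV" and k: "k \<le> CARD('n)"
    and C: "C = vec.span {\<chi> j. (\<sigma> ^^ i) (g $ j) | i. i < k}" and m: "0 < m"
  shows "CARD('n) - vec.dim C \<le> rank_covering_radius K C"
proof -
  define v :: "nat \<Rightarrow> 'a ^ 'n" where "v i = (\<chi> j. (\<sigma> ^^ i) (g $ j))" for i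
  have C_eq: "C = vec.span {v i | i. i < k}" unfolding C v_def ..
  have rk_ge: "CARD('n) - t \<le> rk K (\<Sum>i\<le>t. l i *s v i)" if "l t \<noteq> 0" for l t
  proof -
    have "(\<Sum>i\<le>t. l i *s v i) = (\<chi> j. \<Sum>i\<le>t. l i * (\<sigma> ^^ i) (g $ j))"
      by (simp add: vec_eq_iff v_def)
    then show ?thesis using rk_skew_evaluation_ge[where g = g and l = l and k = t, OF K g that] by simp
  qed
  have indep: "\<forall>i<k. l i = 0" if "(\<Sum>i<k. l i *s v i) = 0" for l
  proof (rule ccontr)
    assume "\<not> ?thesis"
    then have ne: "{i. i < k \<and> l i \<noteq> 0} \<noteq> {}" by blast
    \<comment> \<open>The degree of a supposed relation. Since \<open>t < k \<le> CARD('n)\<close>,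
      the combination would have positive rank, whereas it is zero.\<close>
    define t where "t = Max {i. i < k \<and> l i \<noteq> 0}"
    have t: "t < k" "l t \<noteq> 0" using Max_in[OF _ ne] by (auto simp: t_def)
    have beyond: "l i = 0" if "t < i" "i < k" for i
    proof (rule ccontr)
      assume "l i \<noteq> 0"
      with that(2) have "i \<le> t" unfolding t_def by (intro Max_ge) auto
      with that(1) show False by simp
    qed
    then have "(\<Sum>i\<le>t. l i *s v i) = (\<Sum>i<k. l i *s v i)"
      using t(1) by (intro sum.mono_neutral_left) (auto simp: beyond)
    then have "CARD('n) - t \<le> rk K (0 :: 'a ^ 'n)" using rk_ge[of l t] t(2) that by simp
    moreover have "rk K (0 :: 'a ^ 'n) \<le> card ({} :: 'n set)" by (rule rk_le_card_support) simp
    ultimately show False using t k by simp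
  qed
  \<comment> \<open>Independence is turned into a dimension bound by counting: distinct coefficient
    families give distinct codewords.\<close>
  have "inj_on (\<lambda>u. \<Sum>i<k. u i *s v i) ({..<k} \<rightarrow>\<^sub>E UNIV)"
  proof (rule inj_onI)
    fix a b assume ab: "a \<in> {..<k} \<rightarrow>\<^sub>E UNIV" "b \<in> {..<k} \<rightarrow>\<^sub>E UNIV"
      and "(\<Sum>i<k. a i *s v i) = (\<Sum>i<k. b i *s v i)"
    then have "\<forall>i<k. a i - b i = 0"
      by (intro indep) (simp add: vec.scale_left_diff_distrib sum_subtractf)
    with ab show "a = b" by (intro PiE_ext) auto
  qed
  moreover have "(\<lambda>u. \<Sum>i<k. u i *s v i) ` ({..<k} \<rightarrow>\<^sub>E UNIV) \<subseteq> C"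
    unfolding C_eq by (intro image_subsetI vec.span_sum vec.span_scale vec.span_base) blast
  ultimately have "card ({..<k} \<rightarrow>\<^sub>E (UNIV :: 'a set)) \<le> card C"
    by (rule card_inj_on_le) simp
  also have "\<dots> \<le> CARD('a) ^ vec.dim C" by (rule card_subspace_le) (simp add: C)
  finally have "CARD('a) ^ k \<le> CARD('a) ^ vec.dim C" by (simp add: card_PiE)
  moreover have "CARD('a) > 1" using one_less_power[OF q_gt_1 m] by (simp add: card_UNIV)
  ultimately have kC: "k \<le> vec.dim C" by (simp add: power_increasing_iff)
  have "CARD('n) - k \<le> rank_covering_radius K C"
  proof (rule rank_covering_radius_ge[where x = "v k"])
    show "C \<noteq> {}" using vec.span_zero C by blast
    fix c assume "c \<in> C"
    then obtain u where u: "c = (\<Sum>i<k. u i *s v i)" unfolding C_eq by (rule span_family_obtain)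
    have "(\<Sum>i<k. (if i = k then 1 else - u i) *s v i) = (\<Sum>i<k. - (u i *s v i))"
      by (rule sum.cong) auto
    \<comment> \<open>The difference is the evaluation of a skew polynomial of degree
      \<open>k\<close> with leading coefficient 1.\<close>
    then have "v k - c = (\<Sum>i\<le>k. (if i = k then 1 else - u i) *s v i)"
      by (simp add: u sum_negf flip: lessThan_Suc_atMost)
    then show "CARD('n) - k \<le> rk K (v k - c)" using rk_ge[of "\<lambda>i. if i = k then 1 else - u i" k] by simp
  qed
  with kC show ?thesis by simp
qed

end

text \<open>The skew polynomial argument is applied to \<open>\<sigma> x = x ^ (q ^ a)\<close>.
  Additivity comes from the characteristic, the action on \<open>K\<close> from
  \<open>x ^ q = x\<close> there, and the bound on fixed points from
  \<open>coprime a m\<close>.\<close>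

lemma gabidulin_covering_radius_ge:
  fixes C :: "('a ^ 'n::finite) set"
  assumes q: "primepow q" and m: "0 < m" and C: "generalized_gabidulin_code q m K C"
  shows "CARD('n) - vec.dim C \<le> rank_covering_radius K C"
proof -
  obtain k a and g :: "'a ^ 'n" where k: "k \<le> CARD('n)" and a: "0 < a" "coprime a m"
    and g: "coords_indep K g UNIV" and C: "C = vec.span {(\<chi> j. g $ j ^ (q ^ (a * i))) | i. i < k}"
    using C unfolding generalized_gabidulin_code_def by blast
  define \<sigma> where "\<sigma> x = x ^ (q ^ a)" for x :: 'a
  have pow: "(\<sigma> ^^ i) x = x ^ (q ^ (a * i))" for i x
    by (induction i) (auto simp: \<sigma>_def power_add mult.commute simp flip: power_mult)
  have char: "prime CHAR('a)" "\<exists>s. q = CHAR('a) ^ s"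
    using subfield_card_eq_CHAR_power[OF subfield] q by (auto simp: card_K)
  then obtain s where s: "q = CHAR('a) ^ s" by blast
  have add: "\<sigma> (x + y) = \<sigma> x + \<sigma> y" for x y
    unfolding \<sigma>_def by (rule freshmans_dream'[OF char(1), of _ "s * a"]) (simp add: s power_mult)
  have diff: "\<sigma> (x - y) = \<sigma> x - \<sigma> y" for x y
    using add[of "x - y" y] by simp
  have mult: "\<sigma> (x * y) = \<sigma> x * \<sigma> y" and one: "\<sigma> 1 = 1" for x y
    by (simp_all add: \<sigma>_def power_mult_distrib)
  have K: "c ^ (q ^ i) = c" if "c \<in> K" for c i
    using subfield_power_card[OF subfield finite that]
    by (induction i) (auto simp: card_K power_mult)
  have UNIV: "x ^ (q ^ (m * t)) = x" for x :: 'a and t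
    using subfield_power_card[of UNIV x]
    by (induction t) (auto simp: card_UNIV power_add power_mult subfield_set_def)
  have "card {x. \<sigma> x = x} \<le> q"
  proof -
    \<comment> \<open>Applying \<open>\<sigma>\<close> \<open>s\<close> times to a fixed point
      yields \<open>x = x ^ (q ^ (m * t + 1))\<close>. As \<open>x ^ (q ^ m) = x\<close> on the
      large field, this is \<open>x ^ q\<close>, so fixed points are roots of a polynomial of degree
      \<open>q\<close>.\<close>
    obtain s t where st: "a * s = m * t + 1" using bezout_nat[of a m] a by auto
    have "x ^ q = x" if "\<sigma> x = x" for x
    proof -
      have "(\<sigma> ^^ i) x = x" for i by (induction i) (auto simp: that)
      then have "x = x ^ (q ^ (m * t + 1))" using pow[of s x] st by simp
      also have "\<dots> = x ^ q" using UNIV[of x t] by (simp add: power_mult[of x "q ^ (m * t)" q] mult.commute[of q])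
      finally show ?thesis ..
    qed
    then have "{x. \<sigma> x = x} \<subseteq> {x. poly (monom 1 q + monom (-1) 1) x = 0}"
      by (auto simp: poly_monom)
    moreover have deg: "degree (monom 1 q + monom (-1) 1 :: 'a poly) = q"
      using q_gt_1 by (subst degree_add_eq_left) (auto simp: degree_monom_eq)
    ultimately have "card {x. \<sigma> x = x} \<le> card {x. poly (monom 1 q + monom (-1) 1) x = (0::'a)}"
      by (intro card_mono) auto
    also have "\<dots> \<le> q"
      using card_poly_roots_bound[of "monom 1 q + monom (-1) 1 :: 'a poly"] deg q_gt_1 by force
    finally show ?thesis .
  qed
  moreover have "\<sigma> c = c" if "c \<in> K" for c using K[OF that] by (simp add: \<sigma>_def)
  moreover have "C = vec.span {\<chi> j. (\<sigma> ^^ i) (g $ j) | i. i < k}" by (simp only: C pow)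
  ultimately show ?thesis using diff mult one g k m by (intro skew_span_covering_radius_ge)
qed

end

section \<open>The numerical estimates\<close>

text \<open>Convergence follows from the geometric series. All factors lie between 0 and 1, so the
  limit is positive and below every partial product.\<close>

lemma K_const_bounds:
  assumes "1 < q"
  shows "0 < K_const q" and "K_const q \<le> (\<Prod>i<r. 1 - 1 / real q ^ Suc i)"
proof -
  let ?f = "\<lambda>i. 1 - 1 / real q ^ Suc i"
  have pos: "?f i > 0" for i
    using assms by (simp add: field_simps del: power_Suc)
  have "summable (\<lambda>i. \<bar>- (1 / real q ^ Suc i)\<bar>)"
    using assms summable_mult[OF summable_geometric[of "1 / real q"], of "1 / real q"]
    by (simp add: power_one_over)
  moreover have "- (1 / real q ^ Suc i) \<noteq> -1" for i
    using pos[of i] by (auto simp del: power_Suc)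
  ultimately have "convergent_prod (\<lambda>i. 1 + - (1 / real q ^ Suc i))"
    by (rule summable_imp_convergent_prod_real)
  then have conv: "convergent_prod ?f" by simp
  show "0 < K_const q"
    unfolding K_const_def using conv pos by (rule less_0_prodinf)
  show "K_const q \<le> (\<Prod>i<r. ?f i)"
    unfolding K_const_def
  proof (rule prod_ge_prodinf)
    show "?f has_prod prodinf ?f" using conv by (simp add: convergent_prod_has_prod_iff)
  qed (use pos less_imp_le in auto)
qed

text \<open>Pulling \<open>q ^ r\<close> out of each factor and reversing the index exposes a
  partial product of \<open>K_const q\<close>.\<close>

lemma prod_q_power_diff:
  fixes q r :: nat
  assumes "1 < q"
  shows "real (\<Prod>i<r. q ^ r - q ^ i) = real q ^ (r * r) * (\<Prod>i<r. 1 - 1 / real q ^ Suc i)"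
proof -
  have "real (q ^ r - q ^ i) = real q ^ r * (1 - 1 / real q ^ Suc (r - Suc i))" if "i < r" for i
  proof -
    have "real q ^ r = real q ^ i * real q ^ (r - i)" using that by (simp flip: power_add)
    moreover have "Suc (r - Suc i) = r - i" using that by simp
    ultimately show ?thesis using that assms by (simp add: of_nat_diff power_increasing field_simps)
  qed
  then have "real (\<Prod>i<r. q ^ r - q ^ i) = (\<Prod>i<r. real q ^ r * (1 - 1 / real q ^ Suc (r - Suc i)))"
    by (simp add: of_nat_prod)
  also have "\<dots> = real q ^ (r * r) * (\<Prod>i<r. 1 - 1 / real q ^ Suc (r - Suc i))"
    by (simp add: prod.distrib power_mult)
  also have "(\<Prod>i<r. 1 - 1 / real q ^ Suc (r - Suc i)) = (\<Prod>i<r. 1 - 1 / real q ^ Suc i)"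
    by (rule prod.nat_diff_reindex)
  finally show ?thesis .
qed

text \<open>The first factor \<open>q ^ m - 1\<close> supplies strictness, which is what yields
  \<open>n - k < \<rho> + 1\<close> from a non-strict numerical condition.\<close>

lemma prod_power_diff_less:
  fixes q :: nat
  assumes "1 < q" "0 < r"
  shows "(\<Prod>i<r. q ^ m - q ^ i) < q ^ (m * r)"
proof -
  obtain r' where r: "r = Suc r'" using assms(2) gr0_conv_Suc by blast
  have "(\<Prod>i<r. q ^ m - q ^ i) = (q ^ m - 1) * (\<Prod>i<r'. q ^ m - q ^ Suc i)"
    unfolding r by (simp add: prod.lessThan_Suc_shift del: prod.lessThan_Suc)
  also have "\<dots> \<le> (q ^ m - 1) * (q ^ m) ^ r'"
    using prod_mono[of "{..<r'}" "\<lambda>i. q ^ m - q ^ Suc i" "\<lambda>_. q ^ m"] by (intro mult_left_mono) auto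
  also have "\<dots> < q ^ m * (q ^ m) ^ r'" using assms(1) by (intro mult_strict_right_mono) auto
  also have "\<dots> = q ^ (m * r)" by (simp add: r power_mult power_add)
  finally show ?thesis .
qed

section \<open>Case analysis for the dimension formula\<close>

theorem proposition14:
  fixes q m k \<rho> :: nat
    and K :: "'a::{field,finite} set"
    and C :: "('a ^ 'n::finite) set"
  assumes "primepow q"
    and "0 < m"
    and "CARD('n) \<le> m"
    and "CARD('a) = q ^ m"
    and "subfield_set K"
    and "card K = q"
    and "linear_code k C"
    and "\<rho> = rank_covering_radius K C"
    and "\<rho> \<in> {0, 1, CARD('n) - 1, CARD('n)} \<or>
         real \<rho> * (real CARD('n) - real \<rho>) \<le> real m + log (real q) (K_const q) \<or>
         generalized_gabidulin_code q m K C \<or>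
         elementary_linear_subspace K C"
  shows "int k = int CARD('n) - int \<rho>"
proof -
  interpret finite_field_extension K q m
    using assms(4-6) by unfold_locales
  have C: "vec.subspace C" and k: "k = vec.dim C"
    using assms(7) by (auto simp: linear_code_def)
  have "C \<noteq> {}" using vec.subspace_0[OF C] by blast
  have kn: "k \<le> CARD('n)"
    using vec.dim_subset_UNIV[of C] by (simp add: k vec.dimension_def card_cart_basis)
  have upper: "\<rho> \<le> CARD('n) - k"
    using rank_covering_radius_le_codim[OF C] assms(8) by (simp add: k)
  have sphere: "q ^ (m * (CARD('n) - k)) * (\<Prod>i<\<rho>. q ^ \<rho> - q ^ i)
      \<le> (\<Prod>i<\<rho>. q ^ m - q ^ i) * q ^ (\<rho> * CARD('n))"
    unfolding k
  proof (rule sphere_covering[OF C])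
    show "\<rho> \<le> m" using upper assms(3) by simp
    show "\<exists>c\<in>C. rk K (x - c) \<le> \<rho>" for x
      using rank_covering_radius_attained[OF \<open>C \<noteq> {}\<close>] assms(8) by simp
  qed
  have covered: "CARD('n) - k \<le> \<rho>" if "\<rho> = 0"
  proof -
    have "q ^ (m * (CARD('n) - k)) \<le> q ^ 0" using sphere that by simp
    then have "m * (CARD('n) - k) \<le> 0" using q_gt_1 by (simp only: power_increasing_iff)
    then show ?thesis using assms(2) by simp
  qed
  have elem: "CARD('n) - k \<le> \<rho>" if "elementary_linear_subspace K C"
    using elementary_covering_radius_ge[OF that assms(3)] by (simp add: k assms(8))
  \<comment> \<open>The zero code is elementary with the empty basis.\<close>
  have zero: "CARD('n) - k \<le> \<rho>" if "k = 0"
  proof (rule elem)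
    have "C = {0}" using that vec.subspace_0[OF C] by (auto simp: k vec.dim_eq_0)
    then show "elementary_linear_subspace K C"
      unfolding elementary_linear_subspace_def by (intro exI[of _ "{}"]) (auto simp: vec.independent_empty)
  qed
  have "CARD('n) - k \<le> \<rho>"
    using assms(9)
  proof (elim disjE)
    assume "\<rho> \<in> {0, 1, CARD('n) - 1, CARD('n)}"
    then consider "\<rho> = 0" | "\<rho> = 1" | "\<rho> = CARD('n) - 1 \<or> \<rho> = CARD('n)" by blast
    then show ?thesis
    proof cases
      case 1
      then show ?thesis by (rule covered)
    next
      case 2
      \<comment> \<open>For radius 1 the sphere bound has the factor \<open>q - 1 \<ge> 1\<close> on
        the left and a right side below \<open>q ^ (m * 2)\<close>, because
        \<open>CARD('n) \<le> m\<close>; so the codimension is less than 2.\<close>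
      have "q ^ (m * (CARD('n) - k)) \<le> q ^ (m * (CARD('n) - k)) * (q - 1)" using q_gt_1 by simp
      also have "\<dots> \<le> (q ^ m - 1) * q ^ CARD('n)" using sphere 2 by simp
      also have "\<dots> < q ^ m * q ^ CARD('n)" using q_gt_1 by (intro mult_strict_right_mono) auto
      also have "\<dots> \<le> q ^ m * q ^ m" using q_gt_1 assms(3) by (simp add: power_increasing)
      also have "\<dots> = q ^ (m * 2)" by (simp add: mult_2_right power_add)
      finally have "m * (CARD('n) - k) < m * 2" using q_gt_1 by (simp only: power_strict_increasing_iff)
      then show ?thesis using 2 by simp
    next
      case 3
      \<comment> \<open>For \<open>k > 0\<close> the codimension is at most
        \<open>CARD('n) - 1\<close> anyway.\<close>
      then show ?thesis using zero by (cases "k = 0") auto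
    qed
  next
    assume le: "real \<rho> * (real CARD('n) - real \<rho>) \<le> real m + log (real q) (K_const q)"
    show ?thesis
    \<comment> \<open>Radius 0 is separated because the strict estimate needs a nonempty
      product.\<close>
    proof (cases "\<rho> = 0")
      case True
      then show ?thesis by (rule covered)
    next
      case False
      note Kc = K_const_bounds[OF q_gt_1]
      have "real q ^ (m * (CARD('n) - k) + \<rho> * \<rho>) * K_const q
          \<le> real q ^ (m * (CARD('n) - k)) * (real q ^ (\<rho> * \<rho>) * (\<Prod>i<\<rho>. 1 - 1 / real q ^ Suc i))"
        unfolding power_add mult.assoc using Kc(2) by (intro mult_left_mono) auto
      also have "\<dots> = real (q ^ (m * (CARD('n) - k)) * (\<Prod>i<\<rho>. q ^ \<rho> - q ^ i))"
        unfolding prod_q_power_diff[OF q_gt_1, symmetric] by simp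
      also have "\<dots> \<le> real ((\<Prod>i<\<rho>. q ^ m - q ^ i) * q ^ (\<rho> * CARD('n)))"
        using sphere by (rule of_nat_mono)
      also have "\<dots> < real (q ^ (m * \<rho>) * q ^ (\<rho> * CARD('n)))"
        unfolding of_nat_less_iff using prod_power_diff_less[OF q_gt_1] False q_gt_1
        by (intro mult_strict_right_mono) auto
      also have "\<dots> = real q ^ (m * \<rho> + \<rho> * CARD('n))" by (simp add: power_add)
      finally have "log q (real q ^ (m * (CARD('n) - k) + \<rho> * \<rho>) * K_const q)
          < log q (real q ^ (m * \<rho> + \<rho> * CARD('n)))"
        using q_gt_1 Kc(1) by (subst log_less_cancel_iff) auto
      then have "real (m * (CARD('n) - k) + \<rho> * \<rho>) + log q (K_const q) < real (m * \<rho> + \<rho> * CARD('n))"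
        using q_gt_1 Kc(1) by (simp add: log_mult log_nat_power)
      \<comment> \<open>The numerical condition bounds
        \<open>\<rho> * n - \<rho> * \<rho> - log q (K_const q)\<close> by \<open>m\<close>, with n
        the length.\<close>
      then have "real (m * (CARD('n) - k)) < real (m * Suc \<rho>)"
        using le by (simp add: algebra_simps)
      then have "m * (CARD('n) - k) < m * Suc \<rho>" by (simp only: of_nat_less_iff)
      then have "CARD('n) - k < Suc \<rho>" by (simp only: mult_less_cancel1)
      then show ?thesis by simp
    qed
  next
    assume "generalized_gabidulin_code q m K C"
    then show ?thesis
      using gabidulin_covering_radius_ge[OF assms(1,2)] by (simp add: k assms(8))
  qed (rule elem)
  with upper kn show ?thesis by simp
qed

end
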